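(* Let $(\mathfrak m,x\cdot y,[x,y,z])$ be an irreducible LY-algebra. Then $D(\mathfrak m,\mathfrak m)$ is a semisimple and maximal subalgebra of the standard enveloping Lie algebra $\mathfrak g(\mathfrak m)$. Moreover, $\mathfrak g(\mathfrak m)$ is simple in case $\mathfrak m$ and $D(\mathfrak m,\mathfrak m)$ are not isomorphic as $D(\mathfrak m,\mathfrak m)$-modules.
   Context: Throughout, $k$ is an algebraically closed field of characteristic $0$ and all algebraic systems are finite dimensional over $k$. A Lie-Yamaguti algebra (LY-algebra) $(\mathfrak m,x\cdot y,[x,y,z])$ is a vector space $\mathfrak m$ with a bilinear operation $\cdot:\mathfrak m\times\mathfrak m\to\mathfrak m$ and a trilinear operation $[\,,\,,\,]:\mathfrak m\times\mathfrak m\times\mathfrak m\to\mathfrak m$ such that for all $x,y,z,t,u,v,w\in\mathfrak m$: (LY1) $x\cdot x=0$; (LY2) $[x,x,y]=0$; (LY3) $\sum_{(x,y,z)}([x,y,z]+(x\cdot y)\cdot z)=0$; (LY4) $\sum_{(x,y,z)}[x\cdot y,z,t]=0$; (LY5) $[x,y,u\cdot v]=[x,y,u]\cdot v+u\cdot[x,y,v]$; (LY6) $[x,y,[u,v,w]]=[[x,y,u],v,w]+[u,[x,y,v],w]+[u,v,[x,y,w]]$, where $\sum_{(x,y,z)}$ is the cyclic sum on $x,y,z$. For $x,y\in\mathfrak m$, $D(x,y):\mathfrak m\to\mathfrak m$ is the inner derivation $z\mapsto[x,y,z]$, and $D(\mathfrak m,\mathfrak m)$ is the linear span of all $D(x,y)$,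 which is a Lie algebra under the commutator. It acts naturally on $\mathfrak m$, and it is regarded as a module over itself through the adjoint action. The standard enveloping Lie algebra of $\mathfrak m$ is the vector space $\mathfrak g(\mathfrak m)=D(\mathfrak m,\mathfrak m)\oplus\mathfrak m$ with the anticommutative bracket given, for $x,y,z,t\in\mathfrak m$, by $[D(x,y),D(z,t)]=D([x,y,z],t)+D(z,[x,y,t])$, $[D(x,y),z]=D(x,y)(z)=[x,y,z]$ and $[z,t]=D(z,t)+z\cdot t$. With this bracket $\mathfrak g(\mathfrak m)$ is a Lie algebra containing $D(\mathfrak m,\mathfrak m)$ as a subalgebra. The LY-algebra $\mathfrak m$ is irreducible if $\mathfrak m$ is an irreducible module for its Lie algebra of inner derivations $D(\mathfrak m,\mathfrak m)$.
   Formalization: The simplicity claim additionally assumes that the dimension of m is not 1: if dim m = 1, both operations vanish, D(m,m) = 0 is not isomorphic to m, and g(m) is one-dimensional abelian, hence not simple. *)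

theory Defs
  imports
    "HOL-Computational_Algebra.Polynomial"
    "HOL-Library.Function_Algebras"
    "HOL-Library.Product_Plus"
begin

section \<open>Lie algebras\<close>

text \<open>A Lie algebra is carried by a subspace \<open>L\<close> of an ambient vector space; the bracket
  \<open>br\<close> is only required to behave well on \<open>L\<close>.\<close>

locale lie_algebra = vector_space scale
  for scale :: "'k::field \<Rightarrow> 'g::ab_group_add \<Rightarrow> 'g" +
  fixes L :: "'g set" and br :: "'g \<Rightarrow> 'g \<Rightarrow> 'g"
  assumes subspace_carrier: "subspace L"
    and br_closed: "\<lbrakk>x \<in> L; y \<in> L\<rbrakk> \<Longrightarrow> br x y \<in> L"
    and br_add_left: "\<lbrakk>x \<in> L; y \<in> L; z \<in> L\<rbrakk> \<Longrightarrow> br (x + y) z = br x z + br y z"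
    and br_add_right: "\<lbrakk>x \<in> L; y \<in> L; z \<in> L\<rbrakk> \<Longrightarrow> br x (y + z) = br x y + br x z"
    and br_scale_left: "\<lbrakk>x \<in> L; y \<in> L\<rbrakk> \<Longrightarrow> br (scale c x) y = scale c (br x y)"
    and br_scale_right: "\<lbrakk>x \<in> L; y \<in> L\<rbrakk> \<Longrightarrow> br x (scale c y) = scale c (br x y)"
    and br_self: "x \<in> L \<Longrightarrow> br x x = 0"
    and jacobi: "\<lbrakk>x \<in> L; y \<in> L; z \<in> L\<rbrakk> \<Longrightarrow>
      br (br x y) z + br (br y z) x + br (br z x) y = 0"

definition lie_subalgebra ::
    "('k::field \<Rightarrow> 'g::ab_group_add \<Rightarrow> 'g) \<Rightarrow> 'g set \<Rightarrow> ('g \<Rightarrow> 'g \<Rightarrow> 'g) \<Rightarrow> 'g set \<Rightarrow> bool" where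
  "lie_subalgebra scale L br H \<longleftrightarrow>
     H \<subseteq> L \<and> module.subspace scale H \<and> (\<forall>x\<in>H. \<forall>y\<in>H. br x y \<in> H)"

definition lie_ideal ::
    "('k::field \<Rightarrow> 'g::ab_group_add \<Rightarrow> 'g) \<Rightarrow> 'g set \<Rightarrow> ('g \<Rightarrow> 'g \<Rightarrow> 'g) \<Rightarrow> 'g set \<Rightarrow> bool" where
  "lie_ideal scale L br I \<longleftrightarrow>
     I \<subseteq> L \<and> module.subspace scale I \<and> (\<forall>x\<in>L. \<forall>y\<in>I. br x y \<in> I)"

definition maximal_lie_subalgebra ::
    "('k::field \<Rightarrow> 'g::ab_group_add \<Rightarrow> 'g) \<Rightarrow> 'g set \<Rightarrow> ('g \<Rightarrow> 'g \<Rightarrow> 'g) \<Rightarrow> 'g set \<Rightarrow> bool" where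
  "maximal_lie_subalgebra scale L br H \<longleftrightarrow>
     lie_algebra scale L br \<and> lie_subalgebra scale L br H \<and> H \<noteq> L \<and>
     (\<forall>K. lie_subalgebra scale L br K \<and> H \<subseteq> K \<longrightarrow> K = H \<or> K = L)"

definition derived_lie_algebra ::
    "('k::field \<Rightarrow> 'g::ab_group_add \<Rightarrow> 'g) \<Rightarrow> ('g \<Rightarrow> 'g \<Rightarrow> 'g) \<Rightarrow> 'g set \<Rightarrow> 'g set" where
  "derived_lie_algebra scale br L = module.span scale {br x y | x y. x \<in> L \<and> y \<in> L}"

definition solvable_lie_algebra ::
    "('k::field \<Rightarrow> 'g::ab_group_add \<Rightarrow> 'g) \<Rightarrow> 'g set \<Rightarrow> ('g \<Rightarrow> 'g \<Rightarrow> 'g) \<Rightarrow> bool" where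
  "solvable_lie_algebra scale L br \<longleftrightarrow> (\<exists>n. (derived_lie_algebra scale br ^^ n) L = {0})"

text \<open>Semisimple means that the solvable radical is zero; the zero Lie algebra qualifies.\<close>

definition semisimple_lie_algebra ::
    "('k::field \<Rightarrow> 'g::ab_group_add \<Rightarrow> 'g) \<Rightarrow> 'g set \<Rightarrow> ('g \<Rightarrow> 'g \<Rightarrow> 'g) \<Rightarrow> bool" where
  "semisimple_lie_algebra scale L br \<longleftrightarrow>
     lie_algebra scale L br \<and>
     (\<forall>I. lie_ideal scale L br I \<and> solvable_lie_algebra scale I br \<longrightarrow> I = {0})"

definition simple_lie_algebra ::
    "('k::field \<Rightarrow> 'g::ab_group_add \<Rightarrow> 'g) \<Rightarrow> 'g set \<Rightarrow> ('g \<Rightarrow> 'g \<Rightarrow> 'g) \<Rightarrow> bool" where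
  "simple_lie_algebra scale L br \<longleftrightarrow>
     lie_algebra scale L br \<and> (\<exists>x\<in>L. \<exists>y\<in>L. br x y \<noteq> 0) \<and>
     (\<forall>I. lie_ideal scale L br I \<longrightarrow> I = {0} \<or> I = L)"


section \<open>Modules of Lie algebras\<close>

locale lie_module = lie_algebra scaleL L br + V: vector_space scaleV
  for scaleL :: "'k::field \<Rightarrow> 'g::ab_group_add \<Rightarrow> 'g" and L br
    and scaleV :: "'k \<Rightarrow> 'v::ab_group_add \<Rightarrow> 'v" +
  fixes V :: "'v set" and act :: "'g \<Rightarrow> 'v \<Rightarrow> 'v"
  assumes subspace_module: "V.subspace V"
    and act_closed: "\<lbrakk>x \<in> L; v \<in> V\<rbrakk> \<Longrightarrow> act x v \<in> V"
    and act_add_left: "\<lbrakk>x \<in> L; y \<in> L; v \<in> V\<rbrakk> \<Longrightarrow> act (x + y) v = act x v + act y v"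
    and act_add_right: "\<lbrakk>x \<in> L; v \<in> V; w \<in> V\<rbrakk> \<Longrightarrow> act x (v + w) = act x v + act x w"
    and act_scale_left: "\<lbrakk>x \<in> L; v \<in> V\<rbrakk> \<Longrightarrow> act (scaleL c x) v = scaleV c (act x v)"
    and act_scale_right: "\<lbrakk>x \<in> L; v \<in> V\<rbrakk> \<Longrightarrow> act x (scaleV c v) = scaleV c (act x v)"
    and act_br: "\<lbrakk>x \<in> L; y \<in> L; v \<in> V\<rbrakk> \<Longrightarrow> act (br x y) v = act x (act y v) - act y (act x v)"

lemma (in lie_algebra) br_swap:
  assumes x: "x \<in> L" and y: "y \<in> L"
  shows "br x y = - br y x"
proof -
  have xy: "x + y \<in> L"
    using x y by (rule subspace_add[OF subspace_carrier])
  have "br x y + br y x = br (x + y) (x + y)"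
    using x y xy by (simp add: br_add_left br_add_right br_self[OF x] br_self[OF y])
  also have "\<dots> = 0" by (rule br_self[OF xy])
  finally have "br x y + br y x = 0" .
  then show ?thesis by (simp add: eq_neg_iff_add_eq_0)
qed

lemma (in lie_algebra) lie_module_adjoint: "lie_module scale L br scale L br"
proof (intro lie_module.intro lie_algebra_axioms vector_space_axioms lie_module_axioms.intro)
  fix x y v assume x: "x \<in> L" and y: "y \<in> L" and v: "v \<in> L"
  have "br (br y v) x = - br x (br y v)" "br (br v x) y = - br y (br v x)"
    using x y v by (auto intro: br_swap br_closed)
  moreover have "br y (br v x) = - br y (br x v)"
    using x y v br_scale_right[of y "br x v" "- 1"]
    by (subst br_swap[of v x]) (auto intro: br_closed)
  ultimately show "br (br x y) v = br x (br y v) - br y (br x v)"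
    using jacobi[OF x y v] by (simp add: algebra_simps)
qed (auto simp: subspace_carrier br_closed br_add_left br_add_right br_scale_left br_scale_right)

definition irreducible_lie_module ::
    "('k::field \<Rightarrow> 'g::ab_group_add \<Rightarrow> 'g) \<Rightarrow> 'g set \<Rightarrow> ('g \<Rightarrow> 'g \<Rightarrow> 'g) \<Rightarrow>
     ('k \<Rightarrow> 'v::ab_group_add \<Rightarrow> 'v) \<Rightarrow> 'v set \<Rightarrow> ('g \<Rightarrow> 'v \<Rightarrow> 'v) \<Rightarrow> bool" where
  "irreducible_lie_module scaleL L br scaleV V act \<longleftrightarrow>
     lie_module scaleL L br scaleV V act \<and> V \<noteq> {0} \<and>
     (\<forall>W. W \<subseteq> V \<and> module.subspace scaleV W \<and> (\<forall>x\<in>L. \<forall>w\<in>W. act x w \<in> W) \<longrightarrow> W = {0} \<or> W = V)"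

definition lie_module_isomorphic ::
    "('k::field \<Rightarrow> 'g::ab_group_add \<Rightarrow> 'g) \<Rightarrow> 'g set \<Rightarrow> ('g \<Rightarrow> 'g \<Rightarrow> 'g) \<Rightarrow>
     ('k \<Rightarrow> 'v::ab_group_add \<Rightarrow> 'v) \<Rightarrow> 'v set \<Rightarrow> ('g \<Rightarrow> 'v \<Rightarrow> 'v) \<Rightarrow>
     ('k \<Rightarrow> 'w::ab_group_add \<Rightarrow> 'w) \<Rightarrow> 'w set \<Rightarrow> ('g \<Rightarrow> 'w \<Rightarrow> 'w) \<Rightarrow> bool" where
  "lie_module_isomorphic scaleL L br scaleV V actV scaleW W actW \<longleftrightarrow>
     lie_module scaleL L br scaleV V actV \<and> lie_module scaleL L br scaleW W actW \<and>
     (\<exists>\<phi>. bij_betw \<phi> V W \<and>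
        (\<forall>u\<in>V. \<forall>v\<in>V. \<phi> (u + v) = \<phi> u + \<phi> v) \<and>
        (\<forall>c. \<forall>v\<in>V. \<phi> (scaleV c v) = scaleW c (\<phi> v)) \<and>
        (\<forall>x\<in>L. \<forall>v\<in>V. \<phi> (actV x v) = actW x (\<phi> v)))"


section \<open>Lie-Yamaguti algebras\<close>

locale lie_yamaguti_algebra = vector_space scale
  for scale :: "'k::field \<Rightarrow> 'm::ab_group_add \<Rightarrow> 'm" +
  fixes mul :: "'m \<Rightarrow> 'm \<Rightarrow> 'm" and tri :: "'m \<Rightarrow> 'm \<Rightarrow> 'm \<Rightarrow> 'm"
  assumes mul_linear_1: "Vector_Spaces.linear scale scale (\<lambda>x. mul x y)"
    and mul_linear_2: "Vector_Spaces.linear scale scale (\<lambda>y. mul x y)"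
    and tri_linear_1: "Vector_Spaces.linear scale scale (\<lambda>x. tri x y z)"
    and tri_linear_2: "Vector_Spaces.linear scale scale (\<lambda>y. tri x y z)"
    and tri_linear_3: "Vector_Spaces.linear scale scale (\<lambda>z. tri x y z)"
    and LY1: "mul x x = 0"
    and LY2: "tri x x y = 0"
    and LY3: "(tri x y z + mul (mul x y) z) + (tri y z x + mul (mul y z) x)
              + (tri z x y + mul (mul z x) y) = 0"
    and LY4: "tri (mul x y) z t + tri (mul y z) x t + tri (mul z x) y t = 0"
    and LY5: "tri x y (mul u v) = mul (tri x y u) v + mul u (tri x y v)"
    and LY6: "tri x y (tri u v w) = tri (tri x y u) v w + tri u (tri x y v) w + tri u v (tri x y w)"

text \<open>Linear maps on the algebra live in the function space, with pointwise operations.\<close>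

definition scale_fun :: "('k \<Rightarrow> 'm \<Rightarrow> 'm) \<Rightarrow> 'k \<Rightarrow> ('m \<Rightarrow> 'm) \<Rightarrow> ('m \<Rightarrow> 'm)" where
  "scale_fun scale c f = (\<lambda>x. scale c (f x))"

definition commutator :: "('m::ab_group_add \<Rightarrow> 'm) \<Rightarrow> ('m \<Rightarrow> 'm) \<Rightarrow> ('m \<Rightarrow> 'm)" where
  "commutator f g = (\<lambda>x. f (g x) - g (f x))"

definition inner_derivation :: "('m \<Rightarrow> 'm \<Rightarrow> 'm \<Rightarrow> 'm) \<Rightarrow> 'm \<Rightarrow> 'm \<Rightarrow> ('m \<Rightarrow> 'm)" where
  "inner_derivation tri x y = (\<lambda>z. tri x y z)"

definition inner_derivations ::
    "('k::field \<Rightarrow> 'm::ab_group_add \<Rightarrow> 'm) \<Rightarrow> ('m \<Rightarrow> 'm \<Rightarrow> 'm \<Rightarrow> 'm) \<Rightarrow> ('m \<Rightarrow> 'm) set" where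
  "inner_derivations scale tri =
     module.span (scale_fun scale) {inner_derivation tri x y | x y. True}"

text \<open>One-dimensional algebras count as irreducible.  Both their operations vanish, so there are no
  nonzero inner derivations and the standard enveloping algebra is one-dimensional and abelian; a
  claim that it is simple has to exclude them.\<close>

definition irreducible_lie_yamaguti_algebra ::
    "('k::field \<Rightarrow> 'm::ab_group_add \<Rightarrow> 'm) \<Rightarrow> ('m \<Rightarrow> 'm \<Rightarrow> 'm) \<Rightarrow> ('m \<Rightarrow> 'm \<Rightarrow> 'm \<Rightarrow> 'm) \<Rightarrow> bool" where
  "irreducible_lie_yamaguti_algebra scale mul tri \<longleftrightarrow>
     lie_yamaguti_algebra scale mul tri \<and>
     irreducible_lie_module (scale_fun scale) (inner_derivations scale tri) commutator
       scale UNIV (\<lambda>d x. d x)"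


section \<open>The standard enveloping Lie algebra\<close>

text \<open>A pair \<open>(d, x)\<close> stands for \<open>d + x\<close> in the direct sum of the inner derivations and the
  algebra.  On inner derivations the bracket is the commutator, which is the bilinear extension of
  the usual formula on generators; see \<open>env_bracket_generators\<close> below.\<close>

definition env_scale ::
    "('k \<Rightarrow> 'm \<Rightarrow> 'm) \<Rightarrow> 'k \<Rightarrow> ('m \<Rightarrow> 'm) \<times> 'm \<Rightarrow> ('m \<Rightarrow> 'm) \<times> 'm" where
  "env_scale scale c a = (scale_fun scale c (fst a), scale c (snd a))"

definition env_carrier ::
    "('k::field \<Rightarrow> 'm::ab_group_add \<Rightarrow> 'm) \<Rightarrow> ('m \<Rightarrow> 'm \<Rightarrow> 'm \<Rightarrow> 'm) \<Rightarrow> (('m \<Rightarrow> 'm) \<times> 'm) set" where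
  "env_carrier scale tri = inner_derivations scale tri \<times> UNIV"

definition env_bracket ::
    "('m \<Rightarrow> 'm \<Rightarrow> 'm) \<Rightarrow> ('m \<Rightarrow> 'm \<Rightarrow> 'm \<Rightarrow> 'm) \<Rightarrow>
     ('m \<Rightarrow> 'm) \<times> 'm \<Rightarrow> ('m \<Rightarrow> 'm) \<times> 'm \<Rightarrow> ('m \<Rightarrow> 'm) \<times> ('m::ab_group_add)" where
  "env_bracket mul tri a b =
     (commutator (fst a) (fst b) + inner_derivation tri (snd a) (snd b),
      fst a (snd b) - fst b (snd a) + mul (snd a) (snd b))"

definition env_inner_derivations ::
    "('k::field \<Rightarrow> 'm::ab_group_add \<Rightarrow> 'm) \<Rightarrow> ('m \<Rightarrow> 'm \<Rightarrow> 'm \<Rightarrow> 'm) \<Rightarrow> (('m \<Rightarrow> 'm) \<times> 'm) set" where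
  "env_inner_derivations scale tri = inner_derivations scale tri \<times> {0}"

lemma vector_space_scale_fun:
  assumes "vector_space scale"
  shows "vector_space (scale_fun scale)"
proof -
  interpret vector_space scale by fact
  show ?thesis
    by unfold_locales
      (auto simp: scale_fun_def fun_eq_iff scale_right_distrib scale_left_distrib)
qed

lemma vector_space_env_scale:
  assumes "vector_space scale"
  shows "vector_space (env_scale scale)"
proof -
  interpret vector_space scale by fact
  show ?thesis
    by unfold_locales
      (auto simp: env_scale_def scale_fun_def fun_eq_iff scale_right_distrib scale_left_distrib)
qed

context lie_yamaguti_algebra
begin

interpretation F: vector_space "scale_fun scale"
  by (rule vector_space_scale_fun) unfold_locales

lemma mul_simps:
  "mul (x + y) z = mul x z + mul y z" "mul x (y + z) = mul x y + mul x z"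
  "mul (scale c x) y = scale c (mul x y)" "mul x (scale c y) = scale c (mul x y)"
  "mul 0 y = 0" "mul x 0 = 0"
proof -
  interpret a: Vector_Spaces.linear scale scale "\<lambda>x. mul x y" for y by (rule mul_linear_1)
  interpret b: Vector_Spaces.linear scale scale "\<lambda>y. mul x y" for x by (rule mul_linear_2)
  show "mul (x + y) z = mul x z + mul y z" by (rule a.add)
  show "mul x (y + z) = mul x y + mul x z" by (rule b.add)
  show "mul (scale c x) y = scale c (mul x y)" by (rule a.scale)
  show "mul x (scale c y) = scale c (mul x y)" by (rule b.scale)
  show "mul 0 y = 0" by (rule a.zero)
  show "mul x 0 = 0" by (rule b.zero)
qed

lemma tri_simps:
  "tri (x + y) z t = tri x z t + tri y z t" "tri x (y + z) t = tri x y t + tri x z t"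
  "tri x y (z + t) = tri x y z + tri x y t"
  "tri (scale c x) y z = scale c (tri x y z)" "tri x (scale c y) z = scale c (tri x y z)"
  "tri x y (scale c z) = scale c (tri x y z)"
  "tri 0 y z = 0" "tri x 0 z = 0" "tri x y 0 = 0" "tri x y (- z) = - tri x y z"
proof -
  interpret a: Vector_Spaces.linear scale scale "\<lambda>x. tri x y z" for y z by (rule tri_linear_1)
  interpret b: Vector_Spaces.linear scale scale "\<lambda>y. tri x y z" for x z by (rule tri_linear_2)
  interpret c: Vector_Spaces.linear scale scale "\<lambda>z. tri x y z" for x y by (rule tri_linear_3)
  show "tri (x + y) z t = tri x z t + tri y z t" by (rule a.add)
  show "tri x (y + z) t = tri x y t + tri x z t" by (rule b.add)
  show "tri x y (z + t) = tri x y z + tri x y t" by (rule c.add)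
  show "tri (scale c x) y z = scale c (tri x y z)" by (rule a.scale)
  show "tri x (scale c y) z = scale c (tri x y z)" by (rule b.scale)
  show "tri x y (scale c z) = scale c (tri x y z)" by (rule c.scale)
  show "tri 0 y z = 0" by (rule a.zero)
  show "tri x 0 z = 0" by (rule b.zero)
  show "tri x y 0 = 0" by (rule c.zero)
  show "tri x y (- z) = - tri x y z" by (rule c.neg)
qed

lemma tri_diff:
  "tri (x - y) z t = tri x z t - tri y z t" "tri x (y - z) t = tri x y t - tri x z t"
  using tri_simps(1)[of "x - y" y z t] tri_simps(2)[of x "y - z" z t] by (simp_all add: eq_diff_eq)

lemma mul_diff: "mul (x - y) z = mul x z - mul y z" "mul x (y - z) = mul x y - mul x z"
  using mul_simps(1)[of "x - y" y z] mul_simps(2)[of x "y - z" z] by (simp_all add: eq_diff_eq)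

lemma mul_swap: "mul x y = - mul y x"
  using LY1[of "x + y"] LY1[of x] LY1[of y]
  by (simp add: mul_simps eq_neg_iff_add_eq_0 add.commute)

lemma tri_swap: "tri x y z = - tri y x z"
  using LY2[of "x + y" z] LY2[of x z] LY2[of y z]
  by (simp add: tri_simps eq_neg_iff_add_eq_0 add.commute)

lemma env_bracket_generators:
  "env_bracket mul tri (inner_derivation tri x y, 0) (inner_derivation tri z t, 0) =
     (inner_derivation tri (tri x y z) t + inner_derivation tri z (tri x y t), 0)"
  "env_bracket mul tri (inner_derivation tri x y, 0) (0, z) = (0, tri x y z)"
  "env_bracket mul tri (0, z) (0, t) = (inner_derivation tri z t, mul z t)"
  by (auto simp: env_bracket_def commutator_def inner_derivation_def fun_eq_iff tri_simps
      mul_simps LY6[of x y z t])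

lemma inner_derivation_mem: "inner_derivation tri x y \<in> inner_derivations scale tri"
  unfolding inner_derivations_def by (rule F.span_base) blast

lemma subspace_inner_derivations: "F.subspace (inner_derivations scale tri)"
  unfolding inner_derivations_def by (rule F.subspace_span)

lemma inner_derivations_induct [consumes 1, case_names zero step]:
  assumes "d \<in> inner_derivations scale tri" and "P 0"
    and "\<And>c x y d. d \<in> inner_derivations scale tri \<Longrightarrow> P d \<Longrightarrow>
           P (scale_fun scale c (inner_derivation tri x y) + d)"
  shows "P d"
proof -
  have "d \<in> inner_derivations scale tri \<and> P d"
    using assms(1)[unfolded inner_derivations_def]
  proof (induction rule: F.span_induct_alt)
    case base
    show ?case using assms(2) F.subspace_0[OF subspace_inner_derivations] by blast
  next
    case (step c x d)
    then obtain u v where x: "x = inner_derivation tri u v" by blast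
    have "scale_fun scale c x + d \<in> inner_derivations scale tri"
      using step x F.subspace_add[OF subspace_inner_derivations]
        F.subspace_scale[OF subspace_inner_derivations] inner_derivation_mem by blast
    then show ?case using step assms(3) x by blast
  qed
  then show ?thesis ..
qed

lemma inner_derivations_linear:
  assumes "d \<in> inner_derivations scale tri"
  shows "d (x + y) = d x + d y" "d (scale c x) = scale c (d x)"
proof -
  have "(\<forall>x y. d (x + y) = d x + d y) \<and> (\<forall>c x. d (scale c x) = scale c (d x))"
    using assms
    by (induction rule: inner_derivations_induct)
      (simp_all add: scale_fun_def inner_derivation_def tri_simps scale_right_distrib
        scale_left_commute ac_simps)
  then show "d (x + y) = d x + d y" "d (scale c x) = scale c (d x)" by blast+
qed

lemma inner_derivations_diff:
  assumes "d \<in> inner_derivations scale tri"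
  shows "d (x - y) = d x - d y"
  using inner_derivations_linear(1)[OF assms, of "x - y" y] by (simp add: eq_diff_eq)

lemma inner_derivations_derivation:
  assumes "d \<in> inner_derivations scale tri"
  shows "d (mul x y) = mul (d x) y + mul x (d y)"
    and "d (tri x y z) = tri (d x) y z + tri x (d y) z + tri x y (d z)"
proof -
  have "d (mul x y) = mul (d x) y + mul x (d y) \<and>
        d (tri x y z) = tri (d x) y z + tri x (d y) z + tri x y (d z)"
    using assms
  proof (induction rule: inner_derivations_induct)
    case zero
    show ?case by (simp add: tri_simps mul_simps)
  next
    case (step c u v d)
    then show ?case
      by (simp add: scale_fun_def inner_derivation_def tri_simps mul_simps scale_right_distrib
          LY5[of u v x y] LY6[of u v x y z] algebra_simps)
  qed
  then show "d (mul x y) = mul (d x) y + mul x (d y)"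
    and "d (tri x y z) = tri (d x) y z + tri x (d y) z + tri x y (d z)" by simp_all
qed

lemma commutator_inner_derivations:
  assumes d: "d \<in> inner_derivations scale tri" and e: "e \<in> inner_derivations scale tri"
  shows "commutator d e \<in> inner_derivations scale tri"
  using e
proof (induction rule: inner_derivations_induct)
  case zero
  have "d 0 = 0" using inner_derivations_linear(1)[OF d, of 0 0] by simp
  then have "commutator d 0 = 0" by (simp add: commutator_def fun_eq_iff)
  then show ?case using F.subspace_0[OF subspace_inner_derivations] by (simp only:)
next
  case (step c x y e)
  have "commutator d (scale_fun scale c (inner_derivation tri x y) + e) =
      scale_fun scale c (inner_derivation tri (d x) y + inner_derivation tri x (d y))
      + commutator d e"
    by (simp add: commutator_def fun_eq_iff scale_fun_def inner_derivation_def scale_right_distrib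
        inner_derivations_linear[OF d] inner_derivations_derivation[OF d])
  moreover have "scale_fun scale c (inner_derivation tri (d x) y + inner_derivation tri x (d y))
      + commutator d e \<in> inner_derivations scale tri"
    by (intro F.subspace_add[OF subspace_inner_derivations]
        F.subspace_scale[OF subspace_inner_derivations] inner_derivation_mem step.IH)
  ultimately show ?case by (simp only:)
qed

theorem lie_algebra_inner_derivations:
  "lie_algebra (scale_fun scale) (inner_derivations scale tri) commutator"
proof unfold_locales
  show "F.subspace (inner_derivations scale tri)" by (rule subspace_inner_derivations)
qed (auto simp: commutator_def fun_eq_iff scale_fun_def scale_right_diff_distrib
    inner_derivations_linear inner_derivations_diff algebra_simps
    intro: commutator_inner_derivations[unfolded commutator_def])

lemma subspace_env_carrier: "module.subspace (env_scale scale) (env_carrier scale tri)"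
proof -
  interpret E: vector_space "env_scale scale"
    by (rule vector_space_env_scale) unfold_locales
  show ?thesis
    by (rule E.subspaceI)
      (auto simp: env_carrier_def env_scale_def zero_prod_def
        intro!: F.subspace_0 F.subspace_add F.subspace_scale subspace_inner_derivations)
qed

lemma env_jacobi:
  assumes a: "a \<in> env_carrier scale tri" and b: "b \<in> env_carrier scale tri"
    and c: "c \<in> env_carrier scale tri"
  shows "env_bracket mul tri (env_bracket mul tri a b) c
    + env_bracket mul tri (env_bracket mul tri b c) a
    + env_bracket mul tri (env_bracket mul tri c a) b = 0"
proof -
  obtain d x where a': "a = (d, x)" and d: "d \<in> inner_derivations scale tri"
    using a by (auto simp: env_carrier_def)
  obtain e y where b': "b = (e, y)" and e: "e \<in> inner_derivations scale tri"
    using b by (auto simp: env_carrier_def)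
  obtain f z where c': "c = (f, z)" and f: "f \<in> inner_derivations scale tri"
    using c by (auto simp: env_carrier_def)
  note lin = inner_derivations_linear(1)[OF d] inner_derivations_linear(1)[OF e]
    inner_derivations_linear(1)[OF f]
    inner_derivations_diff[OF d] inner_derivations_diff[OF e] inner_derivations_diff[OF f]
    inner_derivations_derivation[OF d] inner_derivations_derivation[OF e]
    inner_derivations_derivation[OF f] tri_simps mul_simps tri_diff mul_diff
  have 1: "tri (mul x y) z t + tri (mul y z) x t + tri (mul z x) y t = 0" for t
    by (rule LY4)
  have 2: "(tri x y z + mul (mul x y) z) + (tri y z x + mul (mul y z) x)
              + (tri z x y + mul (mul z x) y) = 0" by (rule LY3)
  show ?thesis
    unfolding a' b' c'
    apply (simp add: env_bracket_def commutator_def inner_derivation_def fun_eq_iff zero_prod_def lin)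
    apply (intro conjI allI)
    subgoal for t
      using 1[of t] tri_swap[of "d y" z t] tri_swap[of "d z" y t] tri_swap[of "e x" z t]
      tri_swap[of "e z" x t] tri_swap[of "f x" y t] tri_swap[of "f y" x t]
      by (simp add: algebra_simps)
    subgoal
      using 2 mul_swap[of "d y" z] mul_swap[of "d z" y] mul_swap[of "e x" z]
      mul_swap[of "e z" x] mul_swap[of "f x" y] mul_swap[of "f y" x]
      by (simp add: algebra_simps)
    done
qed

theorem lie_algebra_env:
  "lie_algebra (env_scale scale) (env_carrier scale tri) (env_bracket mul tri)"
proof (intro lie_algebra.intro lie_algebra_axioms.intro)
  show "vector_space (env_scale scale)"
    by (rule vector_space_env_scale) unfold_locales
  show "module.subspace (env_scale scale) (env_carrier scale tri)"
    by (rule subspace_env_carrier)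
  show "env_bracket mul tri a b \<in> env_carrier scale tri"
    if "a \<in> env_carrier scale tri" "b \<in> env_carrier scale tri" for a b
    using that
    by (auto simp: env_carrier_def env_bracket_def intro!: inner_derivation_mem
        F.subspace_add[OF subspace_inner_derivations] commutator_inner_derivations)
  show "env_bracket mul tri (env_bracket mul tri a b) c
      + env_bracket mul tri (env_bracket mul tri b c) a
      + env_bracket mul tri (env_bracket mul tri c a) b = 0"
    if "a \<in> env_carrier scale tri" "b \<in> env_carrier scale tri" "c \<in> env_carrier scale tri"
    for a b c
    using that by (rule env_jacobi)
qed (auto simp: env_carrier_def env_bracket_def env_scale_def commutator_def
    inner_derivation_def scale_fun_def fun_eq_iff zero_prod_def tri_simps mul_simps LY1 LY2
    inner_derivations_linear scale_right_distrib scale_right_diff_distrib)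

theorem lie_module_natural:
  "lie_module (scale_fun scale) (inner_derivations scale tri) commutator scale UNIV (\<lambda>d x. d x)"
proof (intro lie_module.intro lie_algebra_inner_derivations vector_space_axioms
    lie_module_axioms.intro)
qed (auto simp: commutator_def scale_fun_def inner_derivations_linear)

theorem lie_module_adjoint:
  "lie_module (scale_fun scale) (inner_derivations scale tri) commutator
     (scale_fun scale) (inner_derivations scale tri) commutator"
  by (rule lie_algebra.lie_module_adjoint[OF lie_algebra_inner_derivations])

end

end

theory Submission
  imports Defs
begin

text \<open>Write \<open>m\<close> for the algebra, \<open>D\<close> for its inner derivations and \<open>g = D \<oplus> m\<close> for the standard
  enveloping Lie algebra.

  Semisimplicity. It is enough that \<open>D\<close> has no nonzero abelian ideal \<open>A\<close>, because the last nonzero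
  term of the derived series of a solvable ideal is an abelian ideal (\<open>semisimpleI\<close>). The elements
  of \<open>A\<close> commute, so they have a common eigenvector in \<open>m\<close>. Its weight space is stable under \<open>D\<close>,
  provided that the weight vanishes on every commutator \<open>b = [a, x]\<close> with \<open>a \<in> A\<close> and \<open>x \<in> D\<close>.
  It does because \<open>b\<close> is nilpotent. To see this, note that \<open>b\<close> commutes with \<open>a\<close>, so the
  generalised eigenspaces of \<open>a\<close> are stable under \<open>D\<close>; by irreducibility \<open>a\<close> is a scalar plus a
  nilpotent \<open>c\<close> (\<open>irreducible_nilpotent\<close>). Differentiating \<open>c ^ n = 0\<close> repeatedly along \<open>x\<close> then
  exchanges powers of \<open>c\<close> for powers of \<open>b\<close>, at the price of integer factors that characteristic 0
  makes invertible (\<open>nilpotent_commutator\<close>). Irreducibility now forces the weight space to be all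
  of \<open>m\<close>, so \<open>A\<close> consists of scalars (\<open>normalised_commuting_scalar\<close>). A nonzero scalar \<open>c\<close>, however,
  is not an inner derivation: applied to \<open>[x, y, z]\<close> the derivation rule gives \<open>c = 3 c\<close> unless all
  triple products vanish, and then \<open>D = 0\<close> (\<open>inner_derivations_scalar_eq_0\<close>).

  Maximality. A subalgebra \<open>K\<close> that contains \<open>D\<close> is \<open>D \<oplus> (K \<inter> m)\<close>, and \<open>K \<inter> m\<close> is a submodule of the
  irreducible module \<open>m\<close> (\<open>maximal_env_inner_derivations\<close>).

  Simplicity. Let \<open>I\<close> be an ideal of \<open>g\<close> other than \<open>0\<close> and \<open>g\<close>. Irreducibility gives \<open>I \<inter> m = 0\<close>,
  hence \<open>I \<inter> D = 0\<close>, and \<open>I\<close> projects onto \<open>m\<close>; so \<open>I\<close> is the graph of an injective module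
  homomorphism \<open>\<phi>\<close> from \<open>m\<close> to \<open>D\<close>. Bracketing the graph with \<open>m\<close> gives
  \<open>D(y, x) = \<phi> (y \<cdot> x - \<phi> x y)\<close>, so \<open>\<phi>\<close> is onto and \<open>m\<close> is isomorphic to the adjoint module
  (\<open>proper_ideal_imp_isomorphic\<close>). Finally \<open>g\<close> is not abelian, since \<open>D = 0\<close> forces \<open>m\<close> to be
  one-dimensional (\<open>dim_eq_1_if_no_derivations\<close>).\<close>


section \<open>Eigenvectors of operators on an invariant subspace\<close>

text \<open>The vector \<open>p(f) v\<close>, in Horner form. The map \<open>f\<close> is a plain function, as the operators below are
  elements of a function space.\<close>

definition poly_action ::
    "('k::field \<Rightarrow> 'v::ab_group_add \<Rightarrow> 'v) \<Rightarrow> ('v \<Rightarrow> 'v) \<Rightarrow> 'k poly \<Rightarrow> 'v \<Rightarrow> 'v" where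
  "poly_action scale f p v = fold_coeffs (\<lambda>c w. scale c v + f w) p 0"

context vector_space
begin

lemma poly_action_0 [simp]: "poly_action scale f 0 v = 0"
  by (simp add: poly_action_def)

lemma poly_action_pCons:
  assumes "Vector_Spaces.linear scale scale f"
  shows "poly_action scale f (pCons c p) v = scale c v + f (poly_action scale f p v)"
proof -
  interpret f: Vector_Spaces.linear scale scale f by fact
  show ?thesis
    by (cases "p = 0"; cases "c = 0") (simp_all add: poly_action_def f.zero)
qed

lemma poly_action_add:
  assumes "Vector_Spaces.linear scale scale f"
  shows "poly_action scale f (p + q) v = poly_action scale f p v + poly_action scale f q v"
proof -
  interpret f: Vector_Spaces.linear scale scale f by fact
  show ?thesis
    by (induction p q rule: poly_induct2)
      (simp_all add: poly_action_pCons[OF assms] f.add scale_left_distrib algebra_simps)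
qed

lemma poly_action_smult:
  assumes "Vector_Spaces.linear scale scale f"
  shows "poly_action scale f (smult c p) v = scale c (poly_action scale f p v)"
proof -
  interpret f: Vector_Spaces.linear scale scale f by fact
  show ?thesis
    by (induction p)
      (simp_all add: poly_action_pCons[OF assms] f.scale scale_right_distrib)
qed

lemma poly_action_monom:
  assumes "Vector_Spaces.linear scale scale f"
  shows "poly_action scale f (monom c n) v = scale c ((f ^^ n) v)"
proof -
  interpret f: Vector_Spaces.linear scale scale f by fact
  show ?thesis
    by (induction n)
      (simp_all add: monom_0 monom_Suc poly_action_pCons[OF assms] f.scale f.zero)
qed

lemma poly_action_sum:
  assumes "Vector_Spaces.linear scale scale f"
  shows "poly_action scale f (\<Sum>i\<in>I. p i) v = (\<Sum>i\<in>I. poly_action scale f (p i) v)"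
  by (induction I rule: infinite_finite_induct) (simp_all add: poly_action_add[OF assms])

lemma poly_action_linear_factor:
  assumes "Vector_Spaces.linear scale scale f"
  shows "poly_action scale f ([:- c, 1:] * q) v = poly_action scale f q (f v - scale c v)"
proof -
  interpret f: Vector_Spaces.linear scale scale f by fact
  have "poly_action scale f ([:- c, 1:] * q) v =
      f (poly_action scale f q v) - scale c (poly_action scale f q v)"
    using poly_action_add[OF assms, of "pCons 0 q" "smult (- c) q" v]
    by (simp add: add.commute poly_action_smult[OF assms] poly_action_pCons[OF assms] del: smult_minus_left)
  also have "\<dots> = poly_action scale f q (f v - scale c v)"
    by (induction q)
      (simp_all add: poly_action_pCons[OF assms] f.add f.diff f.scale f.zero
        scale_right_distrib scale_right_diff_distrib algebra_simps)
  finally show ?thesis .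
qed

end

text \<open>The vectors \<open>v, f v, f\<^sup>2 v, \<dots>\<close> are too many to be independent. A repetition in this list has to be
  treated apart, since dependence is a property of the set of its entries.\<close>

lemma (in finite_dimensional_vector_space) annihilating_poly:
  assumes f: "Vector_Spaces.linear scale scale f"
  obtains p where "p \<noteq> 0" and "poly_action scale f p v = 0"
proof (cases "inj_on (\<lambda>i. (f ^^ i) v) {..dimension}")
  case False
  then obtain i j where ij: "i \<noteq> j" "(f ^^ i) v = (f ^^ j) v"
    by (auto simp: inj_on_def)
  have "monom 1 i + monom (- 1) j \<noteq> (0 :: 'a poly)"
  proof
    assume "monom 1 i + monom (- 1) j = (0 :: 'a poly)"
    then have "coeff (monom 1 i + monom (- 1) j) i = (0 :: 'a)" by simp
    then show False using ij by simp
  qed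
  moreover have "poly_action scale f (monom 1 i + monom (- 1) j) v = 0"
    using ij by (simp add: poly_action_add[OF f] poly_action_monom[OF f])
  ultimately show ?thesis by (rule that)
next
  case True
  let ?S = "(\<lambda>i. (f ^^ i) v) ` {..dimension}"
  have "card ?S = dimension + 1"
    using True by (simp add: card_image)
  moreover have "dim ?S \<le> dimension"
    by (rule dim_subset_UNIV)
  ultimately have "dependent ?S"
    using independent_card_le_dim[of ?S ?S] by auto
  then obtain g where g: "(\<Sum>w\<in>?S. scale (g w) w) = 0" "\<exists>w\<in>?S. g w \<noteq> 0"
    using dependent_finite[of ?S] by auto
  define h where "h i = g ((f ^^ i) v)" for i
  define p where "p = (\<Sum>i\<le>dimension. monom (h i) i)"
  obtain k where k: "k \<le> dimension" "h k \<noteq> 0"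
    using g(2) by (auto simp: h_def)
  have "coeff p k = h k"
    using k(1) by (simp add: p_def coeff_sum if_distrib)
  then have "p \<noteq> 0" using k(2) by auto
  moreover have "poly_action scale f p v = 0"
    using g(1) True
    by (simp add: p_def poly_action_sum[OF f] poly_action_monom[OF f] sum.reindex h_def)
  ultimately show ?thesis by (rule that)
qed

text \<open>Split an annihilating polynomial of some \<open>v\<close> in \<open>U\<close> into linear factors, one at a time. Either
  \<open>v\<close> is an eigenvector for the root just found, or \<open>f v - c v\<close> is a nonzero vector of \<open>U\<close> that the
  remaining cofactor annihilates.\<close>

lemma eigenvector_in_invariant_subspace:
  fixes scale :: "'k::alg_closed_field \<Rightarrow> 'v::ab_group_add \<Rightarrow> 'v"
  assumes "finite_dimensional_vector_space scale B"
    and f: "Vector_Spaces.linear scale scale f"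
    and U: "module.subspace scale U" "\<forall>u\<in>U. f u \<in> U" and ne: "U \<noteq> {0}"
  obtains u c where "u \<in> U" "u \<noteq> 0" "f u = scale c u"
proof -
  interpret finite_dimensional_vector_space scale B by fact
  obtain v where v: "v \<in> U" "v \<noteq> 0"
    using ne subspace_0[OF U(1)] by blast
  obtain p where p: "p \<noteq> 0" "poly_action scale f p v = 0"
    by (rule annihilating_poly[OF f])
  have "\<exists>u\<in>U. \<exists>c. u \<noteq> 0 \<and> f u = scale c u"
    using p v
  proof (induction "degree p" arbitrary: p v)
    case 0
    then obtain a where a: "p = [:a:]"
      by (metis degree_eq_zeroE)
    interpret f: Vector_Spaces.linear scale scale f by (rule f)
    show ?case
      using 0 a by (simp add: poly_action_pCons[OF f] f.zero)
  next
    case (Suc n)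
    then obtain c where "poly p c = 0"
      using alg_closed_imp_poly_has_root[of p] by auto
    then obtain q where q: "p = [:- c, 1:] * q"
      by (auto simp: poly_eq_0_iff_dvd elim: dvdE)
    have q0: "q \<noteq> 0" using Suc.prems(1) q by auto
    have "degree p = degree q + 1"
      unfolding q using q0 by (subst degree_mult_eq) auto
    then have deg: "n = degree q" using Suc.hyps(2) by simp
    have "poly_action scale f q (f v - scale c v) = 0"
      using Suc.prems(2) unfolding q by (simp only: poly_action_linear_factor[OF f])
    moreover have "f v - scale c v \<in> U"
      using U Suc.prems(3) by (auto intro: subspace_diff subspace_scale)
    ultimately show ?case
      using Suc.hyps(1)[OF deg q0] Suc.prems(3,4) by (cases "f v = scale c v") auto
  qed
  then show ?thesis using that by blast
qed

text \<open>On a stable subspace of least positive dimension every operator of the family is a scalar: its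
  eigenspace there is again stable, because the family commutes, so it cannot be smaller.\<close>

lemma common_eigenvector:
  fixes scale :: "'k::alg_closed_field \<Rightarrow> 'v::ab_group_add \<Rightarrow> 'v"
  assumes "finite_dimensional_vector_space scale B"
    and lin: "\<And>a. a \<in> A \<Longrightarrow> Vector_Spaces.linear scale scale a"
    and comm: "\<And>a b v. a \<in> A \<Longrightarrow> b \<in> A \<Longrightarrow> a (b v) = b (a v)"
    and ne: "(UNIV :: 'v set) \<noteq> {0}"
  obtains u wt where "u \<noteq> 0" "\<And>a. a \<in> A \<Longrightarrow> a u = scale (wt a) u"
proof -
  interpret finite_dimensional_vector_space scale B by fact
  define stable where "stable U \<longleftrightarrow> subspace U \<and> (\<forall>a\<in>A. \<forall>u\<in>U. a u \<in> U) \<and> U \<noteq> {0}" for U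
  have "stable UNIV" using ne by (simp add: stable_def)
  then obtain U where U: "stable U" and min: "\<And>W. stable W \<Longrightarrow> dim U \<le> dim W"
    using ex_has_least_nat[of stable UNIV dim] by blast
  have scalar: "\<exists>c. \<forall>u\<in>U. a u = scale c u" if a: "a \<in> A" for a
  proof -
    interpret a: Vector_Spaces.linear scale scale a by (rule lin[OF a])
    obtain u c where u: "u \<in> U" "u \<noteq> 0" "a u = scale c u"
      using eigenvector_in_invariant_subspace[OF assms(1) lin[OF a], of U] U a
      unfolding stable_def by metis
    define W where "W = {w \<in> U. a w = scale c w}"
    have "subspace W"
      using U unfolding W_def stable_def
      by (intro subspaceI) (simp_all add: subspace_0 subspace_add subspace_scale
          a.add a.scale a.zero scale_right_distrib mult.commute)
    moreover have "b w \<in> W" if b: "b \<in> A" and w: "w \<in> W" for b w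
    proof -
      interpret b: Vector_Spaces.linear scale scale b by (rule lin[OF b])
      show ?thesis
        using w U b comm[OF a b, of w] by (auto simp: W_def stable_def b.scale)
    qed
    moreover have "W \<noteq> {0}" using u by (auto simp: W_def)
    ultimately have "stable W" unfolding stable_def by blast
    then have "W = U"
      using min[of W] U subspace_dim_equal[of W U] by (auto simp: W_def stable_def)
    then show ?thesis unfolding W_def by blast
  qed
  obtain u where u: "u \<in> U" "u \<noteq> 0"
    using U subspace_0[of U] unfolding stable_def by blast
  have "\<forall>a\<in>A. \<exists>c. a u = scale c u" using scalar u(1) by blast
  then obtain wt where "\<forall>a\<in>A. a u = scale (wt a) u" by metis
  then show ?thesis using that u(2) by blast
qed


section \<open>Commuting operators normalised by an irreducible family\<close>

lemma (in vector_space) linear_funpow: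
  assumes "Vector_Spaces.linear scale scale f"
  shows "Vector_Spaces.linear scale scale (f ^^ n)"
proof (induction n)
  case 0
  show ?case by (simp add: linear_id[unfolded id_def])
next
  case (Suc n)
  then show ?case
    using Vector_Spaces.linear_compose[OF Suc.IH assms] by (simp add: comp_def)
qed

lemma funpow_commute:
  assumes "\<And>v. f (g v) = g (f v)"
  shows "(f ^^ n) (g v) = g ((f ^^ n) v)"
  by (induction n) (simp_all add: assms)

text \<open>The rule \<open>[c ^ n, x] = n c ^ (n - 1) b\<close> for \<open>b = [c, x]\<close> commuting with \<open>c\<close>: the commutator with
  \<open>x\<close> acts on powers of \<open>c\<close> like differentiation. For \<open>n = 0\<close> the truncated exponent is harmless,
  as the coefficient vanishes.\<close>

lemma (in vector_space) funpow_commutator: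
  assumes c: "Vector_Spaces.linear scale scale c"
    and cx: "\<And>v. c (x v) = x (c v) + b v" and cb: "\<And>v. c (b v) = b (c v)"
  shows "(c ^^ n) (x v) = x ((c ^^ n) v) + scale (of_nat n) ((c ^^ (n - 1)) (b v))"
proof (induction n)
  case (Suc n)
  interpret c: Vector_Spaces.linear scale scale c by fact
  have "c ((c ^^ (n - 1)) (b v)) = (c ^^ n) (b v)" if "n > 0"
    using that by (cases n) auto
  then show ?case
    using Suc funpow_commute[of c b n v]
    by (cases "n = 0") (simp_all add: cb cx c.add c.scale scale_left_distrib)
qed simp

text \<open>Here \<open>b = [c, x]\<close> and \<open>d = [b, x]\<close>. Commuting \<open>x\<close> with \<open>c ^ (N + 1) b ^ k = 0\<close> gives
  \<open>(N + 1) c ^ N b ^ (k + 1) + k c ^ (N + 1) b ^ (k - 1) d = 0\<close>. One more factor \<open>b\<close> kills the second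
  summand and leaves \<open>c ^ N b ^ (k + 2) = 0\<close>. Iteration trades all factors \<open>c\<close> for factors \<open>b\<close>.\<close>

lemma nilpotent_commutator:
  fixes scale :: "'k::field_char_0 \<Rightarrow> 'v::ab_group_add \<Rightarrow> 'v"
  assumes "vector_space scale"
    and c: "Vector_Spaces.linear scale scale c" and b: "Vector_Spaces.linear scale scale b"
    and x: "Vector_Spaces.linear scale scale x"
    and cx: "\<And>v. c (x v) = x (c v) + b v" and bx: "\<And>v. b (x v) = x (b v) + d v"
    and cb: "\<And>v. c (b v) = b (c v)" and bd: "\<And>v. b (d v) = d (b v)"
    and nil: "\<And>v. (c ^^ n) v = 0"
  shows "\<exists>k. \<forall>v. (b ^^ k) v = 0"
proof -
  interpret vector_space scale by fact
  interpret b: Vector_Spaces.linear scale scale b by fact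
  interpret x: Vector_Spaces.linear scale scale x by fact
  have "\<exists>k. \<forall>v. (c ^^ (n - m)) ((b ^^ k) v) = 0" if "m \<le> n" for m
    using that
  proof (induction m)
    case 0
    show ?case using nil by simp
  next
    case (Suc m)
    then obtain k where k: "\<And>v. (c ^^ (n - m)) ((b ^^ k) v) = 0" by auto
    define N where "N = n - Suc m"
    have N: "n - m = Suc N" using Suc.prems by (simp add: N_def)
    interpret cN: Vector_Spaces.linear scale scale "c ^^ Suc N" by (rule linear_funpow[OF c])
    have "(c ^^ N) ((b ^^ (k + 2)) v) = 0" for v
    proof -
      have k': "(c ^^ Suc N) ((b ^^ j) v) = 0" if "j \<ge> k" for j v
      proof -
        have "(b ^^ j) v = (b ^^ k) ((b ^^ (j - k)) v)"
          using that by (simp flip: funpow_add comp_apply[of "b ^^ k"])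
        then show ?thesis using k N by simp
      qed
      \<comment> \<open>The extra factor \<open>b\<close> is present from the start: the term with \<open>d\<close> then carries
        \<open>b ^ k\<close>, which \<open>c ^ (N + 1)\<close> kills.\<close>
      have "0 = (c ^^ Suc N) ((b ^^ Suc k) (x v))"
        by (rule k'[symmetric]) simp
      also have "(b ^^ Suc k) (x v) = x ((b ^^ Suc k) v) + scale (of_nat (Suc k)) ((b ^^ k) (d v))"
        using funpow_commutator[where c = b and x = x and b = d and n = "Suc k" and v = v, OF b bx bd]
        by simp
      also have "(c ^^ Suc N) \<dots> = (c ^^ Suc N) (x ((b ^^ Suc k) v))"
        by (simp only: cN.add cN.scale k'[OF order.refl] scale_zero_right add_0_right)
      also have "\<dots> = scale (of_nat (Suc N)) ((c ^^ N) (b ((b ^^ Suc k) v)))"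
        using funpow_commutator[where c = c and x = x and b = b and n = "Suc N"
            and v = "(b ^^ Suc k) v", OF c cx cb] k'[of "Suc k" v]
        by (simp add: x.zero del: funpow.simps)
      finally have "scale (of_nat (Suc N)) ((c ^^ N) (b ((b ^^ Suc k) v))) = 0" by (rule sym)
      then show ?thesis by (simp del: of_nat_Suc)
    qed
    then show ?case unfolding N_def by blast
  qed
  from this[of n] show ?thesis by simp
qed

text \<open>The generalised kernel of \<open>c\<close> is stable under each \<open>y\<close> in \<open>D\<close>, since
  \<open>c ^ (m + 1) y v = y c ^ (m + 1) v + (m + 1) c ^ m [c, y] v\<close> and \<open>c\<close> commutes with \<open>[c, y]\<close>. It
  contains \<open>u\<close>, so by irreducibility it is everything.\<close>

lemma irreducible_nilpotent:
  fixes scale :: "'k::field \<Rightarrow> 'v::ab_group_add \<Rightarrow> 'v"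
  assumes "finite_dimensional_vector_space scale B"
    and c: "Vector_Spaces.linear scale scale c"
    and linD: "\<And>y. y \<in> D \<Longrightarrow> Vector_Spaces.linear scale scale y"
    and irr: "\<And>W. module.subspace scale W \<Longrightarrow> \<forall>y\<in>D. \<forall>w\<in>W. y w \<in> W \<Longrightarrow> W = {0} \<or> W = UNIV"
    and comm: "\<And>y v. y \<in> D \<Longrightarrow> c (commutator c y v) = commutator c y (c v)"
    and u: "u \<noteq> 0" "c u = 0"
  obtains n where "\<And>v. (c ^^ n) v = 0"
proof -
  interpret finite_dimensional_vector_space scale B by fact
  interpret c: Vector_Spaces.linear scale scale c by (rule c)
  have c_pow_zero: "(c ^^ n) 0 = 0" for n
    by (induction n) (simp_all add: c.zero)
  have mono: "(c ^^ n) v = 0" if "(c ^^ m) v = 0" "m \<le> n" for m n v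
  proof -
    have "(c ^^ n) v = (c ^^ (n - m)) ((c ^^ m) v)"
      using that(2) by (simp flip: funpow_add comp_apply[of "c ^^ (n - m)"])
    then show ?thesis using that(1) by (simp add: c_pow_zero)
  qed
  have sub: "subspace {v. (c ^^ n) v = 0}" for n
  proof -
    interpret cn: Vector_Spaces.linear scale scale "c ^^ n" by (rule linear_funpow[OF c])
    show ?thesis by (auto intro!: subspaceI simp: cn.zero cn.add cn.scale)
  qed
  define W where "W = {v. \<exists>n. (c ^^ n) v = 0}"
  have "subspace W"
  proof (rule subspaceI)
    show "0 \<in> W" by (auto simp: W_def c_pow_zero)
  next
    fix v w assume "v \<in> W" "w \<in> W"
    then obtain m n where "(c ^^ m) v = 0" "(c ^^ n) w = 0" by (auto simp: W_def)
    then have "(c ^^ max m n) v = 0" "(c ^^ max m n) w = 0" by (auto intro: mono)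
    then show "v + w \<in> W"
      using subspace_add[OF sub[of "max m n"], of v w] by (auto simp: W_def)
  next
    fix r v assume "v \<in> W"
    then obtain m where "(c ^^ m) v = 0" by (auto simp: W_def)
    then show "scale r v \<in> W"
      using subspace_scale[OF sub[of m], of v r] by (auto simp: W_def)
  qed
  moreover have "y v \<in> W" if y: "y \<in> D" and v: "v \<in> W" for y v
  proof -
    interpret y: Vector_Spaces.linear scale scale y by (rule linD[OF y])
    let ?b = "commutator c y"
    have cy: "c (y v) = y (c v) + ?b v" for v by (simp add: commutator_def)
    have b0: "?b 0 = 0" by (simp add: commutator_def y.zero c.zero)
    obtain m where m: "(c ^^ m) v = 0" using v by (auto simp: W_def)
    then have "(c ^^ Suc m) v = 0" by (rule mono) simp
    then have "(c ^^ Suc m) (y v) = 0"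
      using funpow_commutator[where c = c and x = y and b = ?b and n = "Suc m" and v = v,
          OF c cy comm[OF y]] funpow_commute[of c ?b m v] comm[OF y] m
      by (simp add: y.zero b0 del: funpow.simps)
    then show ?thesis unfolding W_def by blast
  qed
  moreover have "u \<in> W" unfolding W_def using u(2) by (auto intro!: exI[of _ 1])
  ultimately have "W = UNIV" using irr[of W] u(1) by blast
  then have "\<forall>v\<in>B. \<exists>n. (c ^^ n) v = 0" by (auto simp: W_def)
  then obtain deg where deg: "\<And>v. v \<in> B \<Longrightarrow> (c ^^ deg v) v = 0" by metis
  \<comment> \<open>The exponent depends on the vector; finitely many basis vectors have a common one.\<close>
  define n where "n = Max (insert 0 (deg ` B))"
  have "B \<subseteq> {v. (c ^^ n) v = 0}"
    using finite_Basis by (auto simp: n_def intro!: mono[OF deg] Max_ge)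
  then have "span B \<subseteq> {v. (c ^^ n) v = 0}" by (rule span_minimal[OF _ sub])
  then show ?thesis using that[of n] span_Basis by blast
qed

text \<open>A form of Lie's theorem for commuting operators normalised by an irreducible family. Commutators
  of \<open>A\<close> with \<open>D\<close> are nilpotent, so the weight of a common eigenvector vanishes on them. Then \<open>D\<close>
  preserves the weight space, which is therefore the whole space.\<close>

lemma normalised_commuting_scalar:
  fixes scale :: "'k::{alg_closed_field, field_char_0} \<Rightarrow> 'v::ab_group_add \<Rightarrow> 'v"
  assumes fd: "finite_dimensional_vector_space scale B"
    and linA: "\<And>a. a \<in> A \<Longrightarrow> Vector_Spaces.linear scale scale a"
    and linD: "\<And>x. x \<in> D \<Longrightarrow> Vector_Spaces.linear scale scale x"
    and comm: "\<And>a b v. a \<in> A \<Longrightarrow> b \<in> A \<Longrightarrow> a (b v) = b (a v)"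
    and norm: "\<And>a x. a \<in> A \<Longrightarrow> x \<in> D \<Longrightarrow> commutator a x \<in> A"
    and ne: "(UNIV :: 'v set) \<noteq> {0}"
    and irr: "\<And>W. module.subspace scale W \<Longrightarrow> \<forall>x\<in>D. \<forall>w\<in>W. x w \<in> W \<Longrightarrow> W = {0} \<or> W = UNIV"
    and a: "a \<in> A"
  shows "\<exists>c. a = scale c"
proof -
  interpret finite_dimensional_vector_space scale B by fact
  obtain u wt where u: "u \<noteq> 0" "\<And>a. a \<in> A \<Longrightarrow> a u = scale (wt a) u"
    using common_eigenvector[OF fd, of A] linA comm ne by metis
  have wt0: "wt (commutator a x) = 0" if a: "a \<in> A" and x: "x \<in> D" for a x
  proof -
    interpret a: Vector_Spaces.linear scale scale a by (rule linA[OF a])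
    \<comment> \<open>Shift the eigenvalue of \<open>u\<close> to 0: this leaves commutators unchanged and makes the
      operator nilpotent.\<close>
    define c where "c v = a v - scale (wt a) v" for v
    have c: "Vector_Spaces.linear scale scale c"
      by unfold_locales
        (simp_all add: c_def a.add a.scale scale_right_distrib scale_right_diff_distrib
          mult.commute)
    have ca: "commutator c y = commutator a y" if "y \<in> D" for y
    proof -
      interpret y: Vector_Spaces.linear scale scale y by (rule linD[OF that])
      show ?thesis by (simp add: fun_eq_iff c_def commutator_def y.diff y.scale)
    qed
    have cb: "c (b v) = b (c v)" if "b \<in> A" for b v
    proof -
      interpret b: Vector_Spaces.linear scale scale b by (rule linA[OF that])
      show ?thesis by (simp add: c_def b.diff b.scale comm[OF a that])
    qed
    have cu: "c u = 0" by (simp add: c_def u(2)[OF a])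
    have c_comm: "c (commutator c y v) = commutator c y (c v)" if "y \<in> D" for y v
      unfolding ca[OF that] by (rule cb[OF norm[OF a that]])
    obtain n where nil: "\<And>v. (c ^^ n) v = 0"
    proof (rule irreducible_nilpotent[where D = D, OF fd c])
      show "Vector_Spaces.linear scale scale y" if "y \<in> D" for y using that by (rule linD)
      show "W = {0} \<or> W = UNIV" if "subspace W" "\<forall>y\<in>D. \<forall>w\<in>W. y w \<in> W" for W
        using that by (rule irr)
      show "c (commutator c y v) = commutator c y (c v)" if "y \<in> D" for y v
        using that by (rule c_comm)
    qed (use u(1) cu in auto)
    let ?b = "commutator a x"
    have b: "?b \<in> A" by (rule norm[OF a x])
    have d: "commutator ?b x \<in> A" by (rule norm[OF b x])
    have cx: "c (x v) = x (c v) + ?b v" for v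
      unfolding ca[OF x, symmetric] by (simp add: commutator_def)
    have "?b (x v) = x (?b v) + commutator ?b x v" for v
      by (simp add: commutator_def[of ?b])
    then obtain k where k: "\<And>v. (?b ^^ k) v = 0"
      using nilpotent_commutator[where c = c and b = ?b and x = x and d = "commutator ?b x" and n = n,
          OF vector_space_axioms c linA[OF b] linD[OF x] cx _ cb[OF b]
          comm[OF b d] nil] by blast
    interpret b: Vector_Spaces.linear scale scale ?b by (rule linA[OF b])
    have "(?b ^^ j) u = scale (wt ?b ^ j) u" for j
      by (induction j) (simp_all add: b.scale u(2)[OF b] mult.commute)
    then show ?thesis using k u(1) by (metis power_eq_0_iff scale_eq_0_iff)
  qed
  define weight_space where "weight_space = {v. \<forall>a\<in>A. a v = scale (wt a) v}"
  have "subspace {v. a v = scale (wt a) v}" if "a \<in> A" for a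
  proof -
    interpret a: Vector_Spaces.linear scale scale a by (rule linA[OF that])
    show ?thesis
      by (intro subspaceI) (simp_all add: a.zero a.add a.scale scale_right_distrib mult.commute)
  qed
  then have "subspace (\<Inter>a\<in>A. {v. a v = scale (wt a) v})"
    by (intro subspace_Inter) blast
  then have "subspace weight_space"
    by (simp add: weight_space_def Collect_ball_eq)
  moreover have "x v \<in> weight_space" if x: "x \<in> D" and v: "v \<in> weight_space" for x v
  proof -
    interpret x: Vector_Spaces.linear scale scale x by (rule linD[OF x])
    have "a (x v) = scale (wt a) (x v)" if a: "a \<in> A" for a
    proof -
      have "commutator a x v = 0"
        using v wt0[OF a x] norm[OF a x] by (auto simp: weight_space_def)
      moreover have "a v = scale (wt a) v" using v a by (simp add: weight_space_def)
      ultimately show ?thesis by (simp add: commutator_def x.scale)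
    qed
    then show ?thesis by (simp add: weight_space_def)
  qed
  moreover have "u \<in> weight_space" using u by (simp add: weight_space_def)
  ultimately have "weight_space = UNIV" using irr[of weight_space] u(1) by blast
  then have "a v = scale (wt a) v" for v using a unfolding weight_space_def by blast
  then show ?thesis by blast
qed


section \<open>Lie algebras without abelian ideals\<close>

lemma (in lie_algebra) lie_algebra_subalgebra:
  assumes "lie_subalgebra scale L br H"
  shows "lie_algebra scale H br"
proof (intro lie_algebra.intro vector_space_axioms lie_algebra_axioms.intro)
  show "subspace H" using assms by (simp add: lie_subalgebra_def)
qed (use assms in \<open>auto simp: lie_subalgebra_def subset_iff br_add_left br_add_right
      br_scale_left br_scale_right br_self jacobi\<close>)

text \<open>Jacobi: \<open>[x, [y, z]] = [[x, y], z] + [y, [x, z]]\<close>, and the ideal absorbs \<open>[x, y]\<close> and \<open>[x, z]\<close>.\<close>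

lemma (in lie_algebra) lie_ideal_derived:
  assumes I: "lie_ideal scale L br I"
  shows "lie_ideal scale L br (derived_lie_algebra scale br I)"
proof -
  have IL: "I \<subseteq> L" and cl: "\<And>x y. x \<in> L \<Longrightarrow> y \<in> I \<Longrightarrow> br x y \<in> I"
    using I by (auto simp: lie_ideal_def)
  let ?S = "{br x y | x y. x \<in> I \<and> y \<in> I}"
  have SL: "span ?S \<subseteq> L"
    using IL by (intro span_minimal subspace_carrier) (auto intro: br_closed)
  have "br x w \<in> span ?S" if x: "x \<in> L" and w: "w \<in> span ?S" for x w
  proof -
    have "w \<in> span ?S \<and> br x w \<in> span ?S"
      using w
    proof (induction rule: span_induct_alt)
      case base
      have "br x 0 = 0"
        using br_scale_right[of x x 0] x by simp
      then show ?case by (simp add: span_zero)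
    next
      case (step c s t)
      then obtain y z where s: "s = br y z" and yz: "y \<in> I" "z \<in> I" by blast
      interpret ad: lie_module scale L br scale L br by (rule lie_module_adjoint)
      have L: "y \<in> L" "z \<in> L" "t \<in> L" "s \<in> L" "scale c s \<in> L"
        using yz IL step SL s br_closed subspace_scale[OF subspace_carrier] by blast+
      have "br x s = br (br x y) z + br y (br x z)"
        using ad.act_br[OF x L(1,2)] by (simp add: s)
      moreover have "br (br x y) z \<in> span ?S" "br y (br x z) \<in> span ?S" "s \<in> span ?S"
        using yz x cl s by (auto intro!: span_base)
      ultimately have "br x s \<in> span ?S" by (simp add: span_add)
      then show ?case
        using step x L \<open>s \<in> span ?S\<close>
        by (auto simp: br_add_right br_scale_right intro: span_add span_scale)
    qed
    then show ?thesis ..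
  qed
  then show ?thesis
    using SL by (simp add: lie_ideal_def derived_lie_algebra_def)
qed

text \<open>The last nonzero term of the derived series of a nonzero solvable ideal is an abelian ideal.\<close>

lemma (in lie_algebra) semisimpleI:
  assumes abelian: "\<And>I. lie_ideal scale L br I \<Longrightarrow> \<forall>x\<in>I. \<forall>y\<in>I. br x y = 0 \<Longrightarrow> I = {0}"
  shows "semisimple_lie_algebra scale L br"
  unfolding semisimple_lie_algebra_def
proof (intro conjI allI impI lie_algebra_axioms)
  fix I assume "lie_ideal scale L br I \<and> solvable_lie_algebra scale I br"
  then have I: "lie_ideal scale L br I"
    and ex: "\<exists>n. (derived_lie_algebra scale br ^^ n) I = {0}"
    by (simp_all add: solvable_lie_algebra_def)
  let ?d = "\<lambda>n. (derived_lie_algebra scale br ^^ n) I"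
  have ideal: "lie_ideal scale L br (?d n)" for n
    by (induction n) (simp_all add: I lie_ideal_derived)
  obtain n where n: "?d n = {0}" and min: "\<And>m. m < n \<Longrightarrow> ?d m \<noteq> {0}"
    using exists_least_iff[THEN iffD1, OF ex] by blast
  show "I = {0}"
  proof (cases n)
    case 0
    then show ?thesis using n by simp
  next
    case (Suc m)
    have d: "derived_lie_algebra scale br (?d m) = {0}" using n Suc by simp
    have "br x y \<in> derived_lie_algebra scale br (?d m)" if "x \<in> ?d m" "y \<in> ?d m" for x y
      unfolding derived_lie_algebra_def[of scale br "?d m"] using that by (intro span_base) blast
    then have "\<forall>x\<in>?d m. \<forall>y\<in>?d m. br x y = 0" unfolding d by blast
    then have "?d m = {0}" by (rule abelian[OF ideal])
    then show ?thesis using min[of m] Suc by simp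
  qed
qed


section \<open>Irreducible Lie-Yamaguti algebras\<close>

context lie_yamaguti_algebra
begin

interpretation F: vector_space "scale_fun scale"
  by (rule vector_space_scale_fun) unfold_locales

lemma inner_derivations_0: "d \<in> inner_derivations scale tri \<Longrightarrow> d 0 = 0"
  using inner_derivations_linear(1)[of d 0 0] by simp

lemma linear_inner_derivation:
  assumes "d \<in> inner_derivations scale tri"
  shows "Vector_Spaces.linear scale scale d"
  by unfold_locales (simp_all add: inner_derivations_linear[OF assms])

lemma zero_inner_derivation: "0 \<in> inner_derivations scale tri"
  by (rule F.subspace_0[OF subspace_inner_derivations])

text \<open>As a derivation of the triple product, the scalar \<open>c\<close> satisfies
  \<open>c [x, y, z] = 3 c [x, y, z]\<close>. So \<open>c \<noteq> 0\<close> would make all triple products vanish. Then 0 is the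
  only inner derivation, but a nonzero scalar does not act as 0 on a nonzero space.\<close>

lemma inner_derivations_scalar_eq_0:
  assumes two: "(2 :: 'k) \<noteq> 0" and ne: "(UNIV :: 'm set) \<noteq> {0}"
    and c: "scale c \<in> inner_derivations scale tri"
  shows "c = 0"
proof (rule ccontr)
  assume "c \<noteq> 0"
  have tri0: "tri x y z = 0" for x y z
  proof -
    let ?t = "scale c (tri x y z)"
    have "?t = ?t + ?t + ?t"
      using inner_derivations_derivation(2)[OF c, of x y z] by (simp add: tri_simps)
    then have "?t + ?t = 0" by (metis add.assoc add_cancel_right_right)
    then have "scale (c + c) (tri x y z) = 0" by (simp only: scale_left_distrib)
    moreover have "c + c \<noteq> 0" using two \<open>c \<noteq> 0\<close> by (simp flip: mult_2)
    ultimately show ?thesis by simp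
  qed
  have "d = 0" if "d \<in> inner_derivations scale tri" for d
    using that
    by (induction rule: inner_derivations_induct)
      (auto simp: scale_fun_def inner_derivation_def fun_eq_iff tri0)
  then have c0: "scale c = 0" using c by blast
  obtain x :: 'm where "x \<noteq> 0" using ne by blast
  then show False using fun_cong[OF c0, of x] \<open>c \<noteq> 0\<close> by simp
qed

lemma env_bracket_derivation_vector:
  "d \<in> inner_derivations scale tri \<Longrightarrow> env_bracket mul tri (d, 0) (0, x) = (0, d x)"
  "d \<in> inner_derivations scale tri \<Longrightarrow> env_bracket mul tri (0, x) (d, 0) = (0, - d x)"
  "d \<in> inner_derivations scale tri \<Longrightarrow> e \<in> inner_derivations scale tri \<Longrightarrow>
    env_bracket mul tri (d, 0) (e, x) = (commutator d e, d x)"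
  "d \<in> inner_derivations scale tri \<Longrightarrow>
    env_bracket mul tri (0, y) (d, x) = (inner_derivation tri y x, mul y x - d y)"
  by (auto simp: env_bracket_def commutator_def inner_derivation_def fun_eq_iff zero_prod_def
      inner_derivations_0 tri_simps mul_simps)

lemma lie_subalgebra_env_inner_derivations:
  "lie_subalgebra (env_scale scale) (env_carrier scale tri) (env_bracket mul tri)
     (env_inner_derivations scale tri)"
proof -
  interpret E: vector_space "env_scale scale"
    by (rule vector_space_env_scale) unfold_locales
  have "E.subspace (env_inner_derivations scale tri)"
    by (rule E.subspaceI)
      (auto simp: env_inner_derivations_def env_scale_def zero_prod_def
        intro!: F.subspace_0 F.subspace_add F.subspace_scale subspace_inner_derivations)
  then show ?thesis
    by (auto simp: lie_subalgebra_def env_inner_derivations_def env_carrier_def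
        env_bracket_derivation_vector inner_derivations_0 commutator_inner_derivations)
qed

end

text \<open>An abelian ideal of the copy of \<open>D\<close> inside the enveloping algebra is a family of commuting
  operators on \<open>m\<close> that \<open>D\<close> normalises, so it consists of scalars, and 0 is the only scalar in \<open>D\<close>.\<close>

lemma semisimple_env_inner_derivations:
  fixes scale :: "'k::{alg_closed_field, field_char_0} \<Rightarrow> 'm::ab_group_add \<Rightarrow> 'm"
  assumes fd: "finite_dimensional_vector_space scale B"
    and irr: "irreducible_lie_yamaguti_algebra scale mul tri"
  shows "semisimple_lie_algebra (env_scale scale)
           (env_inner_derivations scale tri) (env_bracket mul tri)"
proof -
  interpret lie_yamaguti_algebra scale mul tri
    using irr by (simp add: irreducible_lie_yamaguti_algebra_def)
  interpret E: lie_algebra "env_scale scale" "env_inner_derivations scale tri" "env_bracket mul tri"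
    using lie_algebra.lie_algebra_subalgebra[OF lie_algebra_env
        lie_subalgebra_env_inner_derivations] .
  let ?D = "inner_derivations scale tri"
  have ne: "(UNIV :: 'm set) \<noteq> {0}"
    and irr': "\<And>W. subspace W \<Longrightarrow> \<forall>x\<in>?D. \<forall>w\<in>W. x w \<in> W \<Longrightarrow> W = {0} \<or> W = UNIV"
    using irr by (auto simp: irreducible_lie_yamaguti_algebra_def irreducible_lie_module_def)
  show ?thesis
  proof (rule E.semisimpleI)
    fix I
    assume I: "lie_ideal (env_scale scale) (env_inner_derivations scale tri) (env_bracket mul tri) I"
      and ab: "\<forall>x\<in>I. \<forall>y\<in>I. env_bracket mul tri x y = 0"
    have sub: "E.subspace I" using I by (simp add: lie_ideal_def)
    define A where "A = fst ` I"
    have IA: "I = A \<times> {0}" and AD: "A \<subseteq> ?D"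
      using I by (force simp: lie_ideal_def env_inner_derivations_def A_def)+
    have comm: "a (b v) = b (a v)" if "a \<in> A" "b \<in> A" for a b v
    proof -
      have "env_bracket mul tri (a, 0) (b, 0) = 0" using ab that IA by blast
      then have "commutator a b = 0"
        using that AD by (simp add: env_bracket_derivation_vector subset_iff zero_prod_def)
      then show ?thesis by (simp add: commutator_def fun_eq_iff)
    qed
    have norm: "commutator a x \<in> A" if a: "a \<in> A" and x: "x \<in> ?D" for a x
    proof -
      have "env_bracket mul tri (x, 0) (a, 0) \<in> I"
        using I a x IA unfolding lie_ideal_def env_inner_derivations_def by blast
      then have "- (commutator x a, x 0) \<in> I"
        using a x AD E.subspace_neg[OF sub]
        by (auto simp: env_bracket_derivation_vector subset_iff)
      moreover have "- commutator x a = commutator a x"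
        by (simp add: commutator_def fun_eq_iff)
      ultimately show ?thesis using IA by auto
    qed
    have "a = 0" if a: "a \<in> A" for a
    proof -
      have lin: "\<And>a. a \<in> A \<Longrightarrow> Vector_Spaces.linear scale scale a"
        using AD linear_inner_derivation by blast
      have "\<exists>c. a = scale c"
      proof (rule normalised_commuting_scalar[where A = A and D = ?D, OF fd])
        show "a \<in> A" by (rule a)
        show "(UNIV :: 'm set) \<noteq> {0}" by (rule ne)
        show "Vector_Spaces.linear scale scale b" if "b \<in> A" for b
          using that by (rule lin)
        show "Vector_Spaces.linear scale scale x" if "x \<in> ?D" for x
          using that by (rule linear_inner_derivation)
        show "b (c v) = c (b v)" if "b \<in> A" "c \<in> A" for b c v
          using that by (rule comm)
        show "commutator b x \<in> A" if "b \<in> A" "x \<in> ?D" for b x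
          using that by (rule norm)
        show "W = {0} \<or> W = UNIV" if "subspace W" "\<forall>x\<in>?D. \<forall>w\<in>W. x w \<in> W" for W
          using that by (rule irr')
      qed
      then obtain c where c: "a = scale c" ..
      then have "c = 0"
        using inner_derivations_scalar_eq_0[OF _ ne, of c] a AD by auto
      then show ?thesis using c by (simp add: fun_eq_iff)
    qed
    then show "I = {0}"
      using IA E.subspace_0[OF sub] by (auto simp: zero_prod_def)
  qed
qed

locale irreducible_lie_yamaguti = lie_yamaguti_algebra scale mul tri
  for scale :: "'k::field \<Rightarrow> 'm::ab_group_add \<Rightarrow> 'm" and mul tri +
  assumes irreducible: "irreducible_lie_yamaguti_algebra scale mul tri"
begin

interpretation E: lie_algebra "env_scale scale" "env_carrier scale tri" "env_bracket mul tri"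
  by (rule lie_algebra_env)

lemma UNIV_ne_0: "(UNIV :: 'm set) \<noteq> {0}"
  using irreducible
  by (simp add: irreducible_lie_yamaguti_algebra_def irreducible_lie_module_def)

lemma submodule_trivial:
  assumes "subspace W" and "\<And>d w. d \<in> inner_derivations scale tri \<Longrightarrow> w \<in> W \<Longrightarrow> d w \<in> W"
  shows "W = {0} \<or> W = UNIV"
  using irreducible assms
  by (simp add: irreducible_lie_yamaguti_algebra_def irreducible_lie_module_def)

lemma vector_part_trivial:
  assumes K: "module.subspace (env_scale scale) K"
    and stable: "\<And>d x. d \<in> inner_derivations scale tri \<Longrightarrow> (0, x) \<in> K \<Longrightarrow> (0, d x) \<in> K"
  shows "{x. (0, x) \<in> K} = {0} \<or> {x. (0, x) \<in> K} = UNIV"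
proof (rule submodule_trivial)
  show "subspace {x. (0, x) \<in> K}"
  proof (rule subspaceI)
    show "0 \<in> {x. (0, x) \<in> K}" using E.subspace_0[OF K] by (simp add: zero_prod_def)
    show "x + y \<in> {x. (0, x) \<in> K}" if "x \<in> {x. (0, x) \<in> K}" "y \<in> {x. (0, x) \<in> K}" for x y
      using E.subspace_add[OF K, of "(0, x)" "(0, y)"] that by simp
    show "scale c x \<in> {x. (0, x) \<in> K}" if "x \<in> {x. (0, x) \<in> K}" for c x
      using E.subspace_scale[OF K, of "(0, x)" c] that
      by (simp add: env_scale_def scale_fun_def zero_fun_def)
  qed
qed (simp add: stable)

text \<open>A subspace between \<open>D\<close> and \<open>D \<oplus> m\<close> is determined by its intersection with \<open>m\<close>. For a
  subalgebra that intersection is a submodule, because \<open>[d, x] = d x\<close>.\<close>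

lemma maximal_env_inner_derivations:
  "maximal_lie_subalgebra (env_scale scale) (env_carrier scale tri) (env_bracket mul tri)
     (env_inner_derivations scale tri)"
  unfolding maximal_lie_subalgebra_def
proof (intro conjI allI impI lie_algebra_env lie_subalgebra_env_inner_derivations)
  show "env_inner_derivations scale tri \<noteq> env_carrier scale tri"
    using UNIV_ne_0 zero_inner_derivation by (auto simp: env_inner_derivations_def env_carrier_def)
next
  fix K
  assume "lie_subalgebra (env_scale scale) (env_carrier scale tri) (env_bracket mul tri) K \<and>
    env_inner_derivations scale tri \<subseteq> K"
  then have KL: "K \<subseteq> env_carrier scale tri" and K: "E.subspace K"
    and cl: "\<And>a b. a \<in> K \<Longrightarrow> b \<in> K \<Longrightarrow> env_bracket mul tri a b \<in> K"
    and DK: "\<And>d. d \<in> inner_derivations scale tri \<Longrightarrow> (d, 0) \<in> K"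
    by (auto simp: lie_subalgebra_def env_inner_derivations_def)
  have "(0, d x) \<in> K" if "d \<in> inner_derivations scale tri" "(0, x) \<in> K" for d x
    using cl[OF DK that(2), of d] that by (simp add: env_bracket_derivation_vector)
  then have "{x. (0, x) \<in> K} = {0} \<or> {x. (0, x) \<in> K} = UNIV"
    by (rule vector_part_trivial[OF K])
  moreover have "K = inner_derivations scale tri \<times> {x. (0, x) \<in> K}"
  proof -
    have "(d, x) \<in> K \<longleftrightarrow> (0, x) \<in> K" if "d \<in> inner_derivations scale tri" for d x
      using E.subspace_diff[OF K, of "(d, x)" "(d, 0)"] E.subspace_add[OF K, of "(0, x)" "(d, 0)"]
        DK[OF that] by auto
    then show ?thesis using KL by (auto simp: env_carrier_def)
  qed
  ultimately show "K = env_inner_derivations scale tri \<or> K = env_carrier scale tri"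
    unfolding env_inner_derivations_def env_carrier_def by auto
qed

text \<open>The ideal is the graph of the isomorphism \<open>\<phi>\<close>: it meets both summands trivially and projects
  onto \<open>m\<close>. That \<open>\<phi>\<close> hits every generator of \<open>D\<close> is read off from the bracket of \<open>y\<close> in \<open>m\<close> with
  the element \<open>\<phi> x + x\<close> of the graph, namely \<open>D(y, x) + (y \<cdot> x - \<phi> x y)\<close>, which lies in the graph too.\<close>

lemma proper_ideal_imp_isomorphic:
  assumes I: "lie_ideal (env_scale scale) (env_carrier scale tri) (env_bracket mul tri) I"
    and nz: "I \<noteq> {0}" and proper: "I \<noteq> env_carrier scale tri"
  shows "lie_module_isomorphic (scale_fun scale) (inner_derivations scale tri) commutator
           scale UNIV (\<lambda>d x. d x) (scale_fun scale) (inner_derivations scale tri) commutator"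
proof -
  let ?D = "inner_derivations scale tri"
  have IL: "I \<subseteq> env_carrier scale tri" and sub: "E.subspace I"
    using I by (auto simp: lie_ideal_def)
  have ad: "env_bracket mul tri (e, y) (d, x) \<in> I" if "e \<in> ?D" "(d, x) \<in> I" for e y d x
    using I that unfolding lie_ideal_def env_carrier_def by blast
  have ID: "d \<in> ?D" if "(d, x) \<in> I" for d x
    using IL that by (auto simp: env_carrier_def)
  note diff = E.subspace_diff[OF sub]
  have "(0, d x) \<in> I" if "d \<in> ?D" "(0, x) \<in> I" for d x
    using ad[OF that, of 0] that by (simp add: env_bracket_derivation_vector)
  then have "{x. (0, x) \<in> I} = {0} \<or> {x. (0, x) \<in> I} = UNIV"
    by (rule vector_part_trivial[OF sub])
  \<comment> \<open>An ideal that contains \<open>m\<close> contains \<open>D(x, y) = [x, y] - x \<cdot> y\<close>, hence everything.\<close>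
  moreover have "{x. (0, x) \<in> I} \<noteq> UNIV"
  proof
    assume "{x. (0, x) \<in> I} = UNIV"
    then have V: "(0, x) \<in> I" for x by blast
    have gen: "(inner_derivation tri x y, 0) \<in> I" for x y
      using diff[OF ad[OF zero_inner_derivation V, of x y] V[of "mul x y"]]
      by (simp add: env_bracket_generators)
    have "(d, 0) \<in> I" if "d \<in> ?D" for d
      using that
    proof (induction rule: inner_derivations_induct)
      case zero
      show ?case by (rule V)
    next
      case (step c x y d)
      have "env_scale scale c (inner_derivation tri x y, 0) + (d, 0) \<in> I"
        by (intro E.subspace_add[OF sub] E.subspace_scale[OF sub] gen step.IH)
      then show ?case by (simp only: env_scale_def fst_conv snd_conv scale_zero_right add_Pair add_0)
    qed
    then have "(d, 0) + (0, x) \<in> I" if "d \<in> ?D" for d x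
      using that by (intro E.subspace_add[OF sub] V)
    then have "env_carrier scale tri \<subseteq> I" by (auto simp: env_carrier_def)
    then show False using proper IL by simp
  qed
  ultimately have V0: "x = 0" if "(0, x) \<in> I" for x using that by blast
  \<comment> \<open>An element \<open>d\<close> of \<open>I \<inter> D\<close> sends \<open>m\<close> into \<open>I \<inter> m = 0\<close>, and \<open>D\<close> acts faithfully.\<close>
  have D0: "d = 0" if d: "(d, 0) \<in> I" for d
  proof
    fix x
    have "(0, - d x) \<in> I"
      using ad[OF zero_inner_derivation d, of x] ID[OF d]
      by (simp add: env_bracket_derivation_vector(2))
    then show "d x = 0 x" using V0 by fastforce
  qed
  have "snd ` I = {0} \<or> snd ` I = UNIV"
  proof (rule submodule_trivial)
    show "subspace (snd ` I)"
    proof (rule subspaceI)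
      show "0 \<in> snd ` I" using E.subspace_0[OF sub] by force
      show "x + y \<in> snd ` I" if "x \<in> snd ` I" "y \<in> snd ` I" for x y
        using that E.subspace_add[OF sub] by (metis (no_types, lifting) imageE imageI snd_add)
      show "scale c x \<in> snd ` I" if "x \<in> snd ` I" for c x
        using that E.subspace_scale[OF sub] by (force simp: env_scale_def image_iff)
    qed
    show "d x \<in> snd ` I" if d: "d \<in> ?D" and x: "x \<in> snd ` I" for d x
    proof -
      obtain e where e: "(e, x) \<in> I" using x by force
      have "(commutator d e, d x) \<in> I"
        using ad[OF d e, of 0] ID[OF e] d by (simp add: env_bracket_derivation_vector(3))
      then show ?thesis by force
    qed
  qed
  moreover have "snd ` I \<noteq> {0}"
  proof
    assume snd0: "snd ` I = {0}"
    have "a = 0" if a: "a \<in> I" for a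
    proof -
      obtain d x where dx: "a = (d, x)" by (cases a)
      have "x = 0" using snd0 a dx by force
      then show ?thesis using D0 a dx by (simp add: zero_prod_def)
    qed
    then show False using nz E.subspace_0[OF sub] by blast
  qed
  ultimately have "snd ` I = UNIV" by simp
  have "\<exists>d. (d, x) \<in> I" for x
  proof -
    have "x \<in> snd ` I" unfolding \<open>snd ` I = UNIV\<close> by (rule UNIV_I)
    then show ?thesis by (rule imageE) (metis prod.collapse)
  qed
  then obtain \<phi> where \<phi>: "(\<phi> x, x) \<in> I" for x by metis
  have uniq: "\<phi> x = d" if "(d, x) \<in> I" for d x
    using diff[OF \<phi>[of x] that] D0[of "\<phi> x - d"] by simp
  have \<phi>_add: "\<phi> (x + y) = \<phi> x + \<phi> y" for x y
    by (rule uniq) (use E.subspace_add[OF sub \<phi>[of x] \<phi>[of y]] in simp)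
  have \<phi>_scale: "\<phi> (scale c x) = scale_fun scale c (\<phi> x)" for c x
    by (rule uniq) (use E.subspace_scale[OF sub \<phi>[of x], of c] in \<open>simp add: env_scale_def\<close>)
  have \<phi>_act: "\<phi> (d x) = commutator d (\<phi> x)" if d: "d \<in> ?D" for d x
    by (rule uniq)
      (use ad[OF d \<phi>[of x], of 0] ID[OF \<phi>] d in \<open>simp add: env_bracket_derivation_vector(3)\<close>)
  have \<phi>_gen: "inner_derivation tri y x = \<phi> (mul y x - \<phi> x y)" for x y
    by (rule uniq[symmetric])
      (use ad[OF zero_inner_derivation \<phi>[of x], of y] ID[OF \<phi>] in
        \<open>simp add: env_bracket_derivation_vector(4)\<close>)
  have inj: "inj \<phi>"
  proof (rule injI)
    fix x y assume "\<phi> x = \<phi> y"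
    then show "x = y" using diff[OF \<phi>[of x] \<phi>[of y]] V0[of "x - y"] by simp
  qed
  have "d \<in> range \<phi>" if "d \<in> ?D" for d
    using that
  proof (induction rule: inner_derivations_induct)
    case zero
    have "\<phi> 0 = 0" using \<phi>_add[of 0 0] by simp
    then show ?case by (metis rangeI)
  next
    case (step c x y d)
    then obtain w where w: "d = \<phi> w" by blast
    have "scale_fun scale c (inner_derivation tri x y) + d =
        \<phi> (scale c (mul x y - \<phi> y x) + w)"
      by (simp only: w \<phi>_add \<phi>_scale \<phi>_gen)
    then show ?case by (rule range_eqI)
  qed
  then have "bij_betw \<phi> UNIV ?D"
    using inj ID[OF \<phi>] by (auto simp: bij_betw_def)
  then show ?thesis
    unfolding lie_module_isomorphic_def
    by (intro conjI lie_module_natural lie_module_adjoint exI[of _ \<phi>])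
      (simp_all add: \<phi>_add \<phi>_scale \<phi>_act)
qed

text \<open>Without inner derivations every subspace is a submodule.\<close>

lemma dim_eq_1_if_no_derivations:
  assumes "inner_derivations scale tri = {0}"
  shows "dim (UNIV :: 'm set) = 1"
proof -
  obtain x :: 'm where x: "x \<noteq> 0" using UNIV_ne_0 by auto
  have "span {x} = {0} \<or> span {x} = UNIV"
    by (rule submodule_trivial) (auto simp: assms span_zero)
  then have "span {x} = UNIV" using x span_base[of x "{x}"] by auto
  moreover have "dim (span {x}) = 1" using x by (simp add: dim_eq_card_independent)
  ultimately show ?thesis by simp
qed

lemma simple_env:
  assumes dim: "dim (UNIV :: 'm set) \<noteq> 1"
    and noniso: "\<not> lie_module_isomorphic (scale_fun scale) (inner_derivations scale tri) commutator
      scale UNIV (\<lambda>d x. d x) (scale_fun scale) (inner_derivations scale tri) commutator"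
  shows "simple_lie_algebra (env_scale scale) (env_carrier scale tri) (env_bracket mul tri)"
proof -
  obtain d where d: "d \<in> inner_derivations scale tri" "d \<noteq> 0"
    using dim dim_eq_1_if_no_derivations zero_inner_derivation by blast
  then obtain x where "d x \<noteq> 0" by (auto simp: fun_eq_iff)
  then have "env_bracket mul tri (d, 0) (0, x) \<noteq> 0"
    using d by (simp add: env_bracket_derivation_vector zero_prod_def)
  moreover have "(d, 0) \<in> env_carrier scale tri" "(0, x) \<in> env_carrier scale tri"
    using d zero_inner_derivation by (auto simp: env_carrier_def)
  ultimately show ?thesis
    unfolding simple_lie_algebra_def
    using lie_algebra_env proper_ideal_imp_isomorphic noniso by metis
qed

end


section \<open>The enveloping Lie algebra of an irreducible Lie-Yamaguti algebra\<close>

theorem theorem2p1: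
  fixes scale :: "'k::{alg_closed_field, field_char_0} \<Rightarrow> 'm::ab_group_add \<Rightarrow> 'm"
    and Basis :: "'m set"
    and mul :: "'m \<Rightarrow> 'm \<Rightarrow> 'm"
    and tri :: "'m \<Rightarrow> 'm \<Rightarrow> 'm \<Rightarrow> 'm"
  assumes "finite_dimensional_vector_space scale Basis"
    and "irreducible_lie_yamaguti_algebra scale mul tri"
  shows "semisimple_lie_algebra (env_scale scale)
           (env_inner_derivations scale tri) (env_bracket mul tri) \<and>
         maximal_lie_subalgebra (env_scale scale)
           (env_carrier scale tri) (env_bracket mul tri) (env_inner_derivations scale tri) \<and>
         (vector_space.dim scale (UNIV :: 'm set) \<noteq> 1 \<and>
          \<not> lie_module_isomorphic (scale_fun scale) (inner_derivations scale tri) commutator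
              scale UNIV (\<lambda>d x. d x)
              (scale_fun scale) (inner_derivations scale tri) commutator
          \<longrightarrow> simple_lie_algebra (env_scale scale)
                (env_carrier scale tri) (env_bracket mul tri))"
proof -
  interpret irreducible_lie_yamaguti scale mul tri
    using assms(2)
    by (intro irreducible_lie_yamaguti.intro irreducible_lie_yamaguti_axioms.intro)
      (simp_all add: irreducible_lie_yamaguti_algebra_def)
  show ?thesis
  proof (intro conjI impI)
    show "semisimple_lie_algebra (env_scale scale)
        (env_inner_derivations scale tri) (env_bracket mul tri)"
      by (rule semisimple_env_inner_derivations[OF assms])
  qed (use maximal_env_inner_derivations simple_env in simp_all)
qed

end
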